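(* Let $\alpha_i,\beta_i,\gamma_i\in\mathbb{C}$ ($i=0,1,2$) with $(\gamma_1,\gamma_2)\neq(0,0)$ be such that the map $$f(x_1,x_2)=\left(\alpha_0+\alpha_1x_1+\alpha_2x_2,\ \frac{\beta_0+\beta_1x_1+\beta_2x_2}{\gamma_0+\gamma_1x_1+\gamma_2x_2}\right)$$ is birational, and suppose $\alpha_1\gamma_2-\alpha_2\gamma_1=0$. Let $F$ be its extension to $\mathbb{P}^2(\mathbb{C})$, $d_n=\deg(F^n)$, and $\delta(F)$ its dynamical degree. Then: (i) If $\alpha_1\ne0$, $\alpha_2\neq0$, $\gamma_1\neq0$ and $\gamma_2\neq0$, then $\delta(F)=2$. (ii) If $\alpha_1=\gamma_1=0$, then $\delta(F)=\delta^*:=\frac{1+\sqrt5}{2}$ and $d_{n+2}=d_{n+1}+d_n$ for all $n\in\mathbb{N}$. (iii) If $\alpha_2=\gamma_2=0$, then $\delta(F)=1$ and $d_n=1+n$ for all $n\in\mathbb{N}$.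
   Context: A map $f:\mathbb{C}^2\to\mathbb{C}^2$ with rational components is birational if there exist an algebraic curve $V$ and a rational map $g$ with $f\circ g=g\circ f=\mathrm{id}$ on $\mathbb{C}^2\setminus V$. Via the embedding $(x_1,x_2)\mapsto[1:x_1:x_2]$, $f$ induces $F:\mathbb{P}^2(\mathbb{C})\to\mathbb{P}^2(\mathbb{C})$, $F=[F_1:F_2:F_3]$ with $F_1=x_0(\gamma_0x_0+\gamma_1x_1+\gamma_2x_2)$, $F_2=(\alpha_0x_0+\alpha_1x_1+\alpha_2x_2)(\gamma_0x_0+\gamma_1x_1+\gamma_2x_2)$, $F_3=x_0(\beta_0x_0+\beta_1x_1+\beta_2x_2)$. The degree $d_n=\deg(F^n)$ of the iterate $F^n=F\circ\cdots\circ F$ is the common degree of its homogeneous components after removing common factors. The dynamical degree is $\delta(F)=\lim_{n\to\infty}(\deg(F^n))^{1/n}$. *)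

theory Defs
  imports Complex_Main "HOL-Computational_Algebra.Computational_Algebra"
    "HOL-Computational_Algebra.Field_as_Ring"
begin

text \<open>
  The ring \<open>\<complex>[x\<^sub>1, x\<^sub>2]\<close> is the nested polynomial ring \<open>\<complex>[x\<^sub>1][x\<^sub>2]\<close>: the outermost variable
  is \<open>x\<^sub>2\<close>.
\<close>

type_synonym poly2 = "complex poly poly"

definition eval2 :: "poly2 \<Rightarrow> complex \<times> complex \<Rightarrow> complex" where
  "eval2 p z = poly (poly p [:snd z:]) (fst z)"

definition algebraic_curve :: "(complex \<times> complex) set \<Rightarrow> bool" where
  "algebraic_curve V \<longleftrightarrow> (\<exists>p. (\<nexists>c. p = [:[:c:]:]) \<and> V = {z. eval2 p z = 0})"

text \<open>
  A rational map of \<open>\<complex>\<^sup>2\<close> is given by a pair of fractions, each a pair (numerator, denominator).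
  The fractions need not be in lowest terms; a different choice of representatives changes the
  domain only along a curve, which does not affect the notion of birationality below.
\<close>

type_synonym ratmap = "(poly2 \<times> poly2) \<times> (poly2 \<times> poly2)"

definition is_ratmap :: "ratmap \<Rightarrow> bool" where
  "is_ratmap f \<longleftrightarrow> snd (fst f) \<noteq> 0 \<and> snd (snd f) \<noteq> 0"

definition ratmap_dom :: "ratmap \<Rightarrow> (complex \<times> complex) set" where
  "ratmap_dom f = {z. eval2 (snd (fst f)) z \<noteq> 0 \<and> eval2 (snd (snd f)) z \<noteq> 0}"

definition ratmap_apply :: "ratmap \<Rightarrow> complex \<times> complex \<Rightarrow> complex \<times> complex" where
  "ratmap_apply f z =
    (eval2 (fst (fst f)) z / eval2 (snd (fst f)) z, eval2 (fst (snd f)) z / eval2 (snd (snd f)) z)"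

text \<open>
  Since division is total, the identities \<open>f \<circ> g = g \<circ> f = id\<close> off the curve include the
  requirement that the compositions are defined there.
\<close>

definition birational :: "ratmap \<Rightarrow> bool" where
  "birational f \<longleftrightarrow> is_ratmap f \<and>
    (\<exists>V g. algebraic_curve V \<and> is_ratmap g \<and>
      (\<forall>z. z \<notin> V \<longrightarrow>
        z \<in> ratmap_dom g \<and> ratmap_apply g z \<in> ratmap_dom f \<and>
          ratmap_apply f (ratmap_apply g z) = z \<and>
        z \<in> ratmap_dom f \<and> ratmap_apply f z \<in> ratmap_dom g \<and>
          ratmap_apply g (ratmap_apply f z) = z))"

text \<open>
  A parameter vector \<open>(\<alpha>\<^sub>0, \<alpha>\<^sub>1, \<alpha>\<^sub>2)\<close> is a function on \<open>nat\<close> of which only the values at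
  \<open>0, 1, 2\<close> are used.
\<close>

definition affine2 :: "(nat \<Rightarrow> complex) \<Rightarrow> poly2" where
  "affine2 \<alpha> = [:[:\<alpha> 0, \<alpha> 1:], [:\<alpha> 2:]:]"

definition plane_map :: "(nat \<Rightarrow> complex) \<Rightarrow> (nat \<Rightarrow> complex) \<Rightarrow> (nat \<Rightarrow> complex) \<Rightarrow> ratmap" where
  "plane_map \<alpha> \<beta> \<gamma> = ((affine2 \<alpha>, 1), (affine2 \<beta>, affine2 \<gamma>))"

text \<open>
  The ring \<open>\<complex>[x\<^sub>0, x\<^sub>1, x\<^sub>2]\<close> is the nested ring \<open>\<complex>[x\<^sub>0][x\<^sub>1][x\<^sub>2]\<close>; a rational self-map of
  the projective plane is represented by its triple of homogeneous components.
\<close>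

type_synonym poly3 = "complex poly poly poly"
type_synonym projmap = "poly3 \<times> poly3 \<times> poly3"

definition const3 :: "complex \<Rightarrow> poly3" where "const3 c = [:[:[:c:]:]:]"
definition X0 :: poly3 where "X0 = [:[:[:0, 1:]:]:]"
definition X1 :: poly3 where "X1 = [:[:0, 1:]:]"
definition X2 :: poly3 where "X2 = [:0, 1:]"

definition total_degree3 :: "poly3 \<Rightarrow> nat" where
  "total_degree3 p = Max (insert 0 {i + j + k |i j k. coeff (coeff (coeff p k) j) i \<noteq> 0})"

text \<open>Substitution of \<open>(q\<^sub>0, q\<^sub>1, q\<^sub>2)\<close> for \<open>(x\<^sub>0, x\<^sub>1, x\<^sub>2)\<close>, i.e. Horner evaluation in the ring
  \<^typ>\<open>poly3\<close> one variable at a time.\<close>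

definition subst3 :: "poly3 \<Rightarrow> projmap \<Rightarrow> poly3" where
  "subst3 p = (\<lambda>(q0, q1, q2).
    poly (map_poly (\<lambda>r. poly (map_poly (\<lambda>s. poly (map_poly const3 s) q0) r) q1) p) q2)"

definition proj_comp :: "projmap \<Rightarrow> projmap \<Rightarrow> projmap" where
  "proj_comp G F = (case G of (G1, G2, G3) \<Rightarrow> (subst3 G1 F, subst3 G2 F, subst3 G3 F))"

definition proj_iter :: "projmap \<Rightarrow> nat \<Rightarrow> projmap" where
  "proj_iter F n = (proj_comp F ^^ n) (X0, X1, X2)"

text \<open>
  The iterates above are not reduced; common factors are removed only here. For homogeneous
  components the reduced nonzero components all have the same degree, so the maximum is this
  common degree (a component may vanish identically, and \<open>total_degree3 0 = 0\<close>).
\<close>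

definition proj_degree :: "projmap \<Rightarrow> nat" where
  "proj_degree = (\<lambda>(F1, F2, F3). let h = gcd F1 (gcd F2 F3) in
    Max {total_degree3 (F1 div h), total_degree3 (F2 div h), total_degree3 (F3 div h)})"

text \<open>The limit is stated as convergence, so its existence is part of the assertion.\<close>

definition has_dynamical_degree :: "projmap \<Rightarrow> real \<Rightarrow> bool" where
  "has_dynamical_degree F \<delta> \<longleftrightarrow>
    (\<lambda>n. root n (real (proj_degree (proj_iter F n)))) \<longlonglongrightarrow> \<delta>"

definition linear3 :: "(nat \<Rightarrow> complex) \<Rightarrow> poly3" where
  "linear3 \<alpha> = const3 (\<alpha> 0) * X0 + const3 (\<alpha> 1) * X1 + const3 (\<alpha> 2) * X2"

text \<open>
  The extension of \<^term>\<open>plane_map \<alpha> \<beta> \<gamma>\<close> along \<open>(x\<^sub>1, x\<^sub>2) \<mapsto> [1 : x\<^sub>1 : x\<^sub>2]\<close>: homogenise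
  \<open>[1 : A : B / C]\<close> with \<open>A, B, C\<close> affine and clear the denominators \<open>x\<^sub>0\<close> and \<open>C\<close>.
\<close>

definition proj_map :: "(nat \<Rightarrow> complex) \<Rightarrow> (nat \<Rightarrow> complex) \<Rightarrow> (nat \<Rightarrow> complex) \<Rightarrow> projmap" where
  "proj_map \<alpha> \<beta> \<gamma> = (X0 * linear3 \<gamma>, linear3 \<alpha> * linear3 \<gamma>, X0 * linear3 \<beta>)"

end

theory Submission
  imports Defs "HOL-Number_Theory.Fib"
begin

text \<open>
  Birationality and the relation \<open>\<alpha>\<^sub>1 \<gamma>\<^sub>2 = \<alpha>\<^sub>2 \<gamma>\<^sub>1\<close> give \<open>(\<alpha>\<^sub>1, \<alpha>\<^sub>2) = \<kappa> (\<gamma>\<^sub>1, \<gamma>\<^sub>2)\<close> with \<open>\<kappa> \<noteq> 0\<close>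
  and \<open>\<beta>\<^sub>1 \<gamma>\<^sub>2 - \<beta>\<^sub>2 \<gamma>\<^sub>1 \<noteq> 0\<close>; otherwise the image of the map would lie on a curve
  (\<open>birational_nondegenerate\<close>).

  Suppose \<open>\<gamma>\<^sub>2 \<noteq> 0\<close>, as in the first two cases. Let \<open>w\<close> be the value of
  \<open>\<gamma>\<^sub>0 + \<gamma>\<^sub>1 x\<^sub>1 + \<gamma>\<^sub>2 x\<^sub>2\<close>, the denominator of the map, along an orbit. The first coordinate is then an affine function of the previous value of \<open>w\<close>, so in the
  affine coordinates (previous \<open>w\<close>, current \<open>w\<close>) the map is a second-order recurrence
    \<open>w\<^sub>n\<^sub>+\<^sub>1 w\<^sub>n = a w\<^sub>n\<^sup>2 + b w\<^sub>n + c + e w\<^sub>n\<^sub>-\<^sub>1\<close>  with \<open>a = \<alpha>\<^sub>1\<close> and \<open>e \<noteq> 0\<close>.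
  Homogeneously it is \<open>(E, U, W) \<mapsto> (E W, W\<^sup>2, a W\<^sup>2 + b W E + c E\<^sup>2 + e U E)\<close>, and the degree of an
  iterate is determined by the common factors that its components acquire. A prime \<open>\<pi>\<close> that divides
  the new first and third components, but does not divide \<open>E\<close>, divides both \<open>W\<close> and \<open>c E + e U\<close>, so
  the curve \<open>\<pi> = 0\<close> was contracted to the finite point \<open>(-c/e, 0)\<close> one step before. This is
  impossible. Since \<open>e \<noteq> 0\<close>, the recurrence can be run backwards without division, so a curve
  contracted to a finite point is contracted to finite points at all earlier times
  (\<open>constant_along_pullback\<close>), hence also by the identity, which is absurd
  (\<open>not_constant_along_start\<close>). What remains are common factors dividing \<open>E\<close>, and these are explicit.

  If \<open>a \<noteq> 0\<close> there are none, because \<open>E\<close> stays coprime to \<open>W\<close>, and the degree is \<open>2\<^sup>n\<close>. If \<open>a = 0\<close>,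
  write \<open>w\<^sub>n = N\<^sub>n/D\<^sub>n\<close> in lowest terms. Then \<open>D\<^sub>n\<^sub>+\<^sub>2 = D\<^sub>n N\<^sub>n\<^sub>+\<^sub>1\<close>, consecutive denominators are
  coprime, and the reduced triple is \<open>(D\<^sub>n\<^sub>+\<^sub>1 D\<^sub>n, N\<^sub>n D\<^sub>n\<^sub>+\<^sub>1, N\<^sub>n\<^sub>+\<^sub>1 D\<^sub>n)\<close>; exactly the factor \<open>D\<^sub>n\<close>
  splits off in the next step, and the degrees are Fibonacci numbers.

  If \<open>\<alpha>\<^sub>2 = \<gamma>\<^sub>2 = 0\<close>, the first coordinate evolves on its own by an affine map, and every step
  introduces one further vertical line of poles, counted with multiplicity, into the second coordinate. The numerator of the
  latter is affine in \<open>x\<^sub>2\<close>, and its coefficient of \<open>x\<^sub>2\<close> vanishes at most at infinity. So no pole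
  cancels, and the degree grows by exactly one.
\<close>

section \<open>Nested polynomials\<close>

lemma const3_0 [simp]: "const3 0 = 0"
  and const3_1 [simp]: "const3 1 = 1"
  and const3_eq_0_iff [simp]: "const3 c = 0 \<longleftrightarrow> c = 0"
  and const3_add: "const3 (c + d) = const3 c + const3 d"
  and const3_diff: "const3 (c - d) = const3 c - const3 d"
  and const3_uminus: "const3 (- c) = - const3 c"
  and const3_mult: "const3 (c * d) = const3 c * const3 d"
  by (simp_all add: const3_def one_pCons)

lemma const3_inverse: "c \<noteq> 0 \<Longrightarrow> const3 c * const3 (1 / c) = 1"
  by (simp flip: const3_mult)

lemma unit_poly3_eq_const3:
  assumes "is_unit (u :: poly3)"
  obtains c where "u = const3 c" "c \<noteq> 0"
  using assms by (fastforce simp: is_unit_poly_iff const3_def)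

lemma prime_not_dvd_const3:
  assumes "prime (\<pi> :: poly3)" "c \<noteq> 0"
  shows "\<not> \<pi> dvd const3 c"
proof
  assume "\<pi> dvd const3 c"
  then have "\<pi> dvd const3 c * const3 (1 / c)"
    by simp
  then have "is_unit \<pi>"
    using const3_inverse[OF assms(2)] by simp
  with assms(1) show False
    using not_prime_unit by blast
qed

lemma prime_dvd_const3_mult_iff:
  assumes "prime (\<pi> :: poly3)" "c \<noteq> 0"
  shows "\<pi> dvd const3 c * p \<longleftrightarrow> \<pi> dvd p"
  using assms by (simp add: prime_dvd_mult_iff prime_not_dvd_const3)

text \<open>A divisor of a nonzero constant polynomial is itself constant, so it divides a polynomial only
  by dividing each of its coefficients.\<close>

lemma dvd_coeff_if_dvd_const:
  fixes p :: "'a :: idom poly"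
  assumes "p dvd [:q:]" "q \<noteq> 0" "p dvd r"
  shows "p dvd [:coeff r n:]"
proof -
  have "degree p = 0"
    using dvd_imp_degree_le[OF assms(1)] assms(2) by simp
  then obtain c where "p = [:c:]"
    by (elim degree_eq_zeroE)
  then show ?thesis
    using assms(3) const_poly_dvd_iff[of c r] by simp
qed

lemma coprime_if_no_common_prime:
  fixes p q :: poly3
  assumes "p \<noteq> 0" "\<And>\<pi>. prime \<pi> \<Longrightarrow> \<pi> dvd p \<Longrightarrow> \<pi> dvd q \<Longrightarrow> False"
  shows "coprime p q"
proof (rule ccontr)
  assume "\<not> coprime p q"
  then have "\<not> is_unit (gcd p q)"
    using is_unit_gcd by blast
  then obtain \<pi> where "prime \<pi>" "\<pi> dvd gcd p q"
    using prime_divisor_exists[of "gcd p q"] assms(1) by auto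
  then show False
    using assms(2)[of \<pi>] by simp
qed

lemma not_prime_dvd_both:
  assumes "prime \<pi>" "\<pi> dvd p" "\<pi> dvd q" "coprime p (q :: poly3)"
  shows False
  using assms coprime_common_divisor not_prime_unit by blast


section \<open>Homogeneous polynomials and the degree of a map\<close>

definition homogeneous :: "nat \<Rightarrow> poly3 \<Rightarrow> bool" where
  "homogeneous n p \<longleftrightarrow> (\<forall>i j k. coeff (coeff (coeff p k) j) i \<noteq> 0 \<longrightarrow> i + j + k = n)"

lemma homogeneous_const3: "homogeneous 0 (const3 c)"
  and homogeneous_X0: "homogeneous 1 X0"
  and homogeneous_X1: "homogeneous 1 X1"
  and homogeneous_X2: "homogeneous 1 X2"
  by (auto simp: homogeneous_def const3_def X0_def X1_def X2_def coeff_pCons split: nat.splits if_splits)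

lemma homogeneous_add: "homogeneous n p \<Longrightarrow> homogeneous n q \<Longrightarrow> homogeneous n (p + q)"
  and homogeneous_diff: "homogeneous n p \<Longrightarrow> homogeneous n q \<Longrightarrow> homogeneous n (p - q)"
  unfolding homogeneous_def coeff_add coeff_diff by (metis add_0, metis diff_0_right)

lemma homogeneous_mult:
  assumes "homogeneous m p" "homogeneous n q"
  shows "homogeneous (m + n) (p * q)"
  unfolding homogeneous_def
proof (intro allI impI)
  fix i j k
  assume "coeff (coeff (coeff (p * q) k) j) i \<noteq> 0"
  then obtain k' where k: "k' \<le> k" "coeff (coeff (coeff p k' * coeff q (k - k')) j) i \<noteq> 0"
    by (auto simp: coeff_mult[of p] coeff_sum elim!: sum.not_neutral_contains_not_neutral)
  then obtain j' where j: "j' \<le> j"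
    "coeff (coeff (coeff p k') j' * coeff (coeff q (k - k')) (j - j')) i \<noteq> 0"
    by (auto simp: coeff_mult[of "coeff p k'"] coeff_sum elim!: sum.not_neutral_contains_not_neutral)
  then obtain i' where i: "i' \<le> i"
    "coeff (coeff (coeff p k') j') i' * coeff (coeff (coeff q (k - k')) (j - j')) (i - i') \<noteq> 0"
    by (auto simp: coeff_mult[of "coeff (coeff p k') j'"] elim!: sum.not_neutral_contains_not_neutral)
  from i(2) have "coeff (coeff (coeff p k') j') i' \<noteq> 0"
    "coeff (coeff (coeff q (k - k')) (j - j')) (i - i') \<noteq> 0"
    by auto
  then have "i' + j' + k' = m" "(i - i') + (j - j') + (k - k') = n"
    using assms unfolding homogeneous_def by blast+
  with \<open>i' \<le> i\<close> \<open>j' \<le> j\<close> \<open>k' \<le> k\<close> show "i + j + k = m + n"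
    by simp
qed

lemma homogeneous_const3_mult: "homogeneous n p \<Longrightarrow> homogeneous n (const3 c * p)"
  using homogeneous_mult[OF homogeneous_const3, of n p c] by simp

lemma homogeneous_linear3: "homogeneous 1 (linear3 v)"
  unfolding linear3_def
  by (intro homogeneous_add homogeneous_const3_mult homogeneous_X0 homogeneous_X1 homogeneous_X2)

lemma total_degree3_homogeneous:
  assumes "homogeneous n p"
  shows "total_degree3 p = (if p = 0 then 0 else n)"
proof (cases "p = 0")
  case True
  then show ?thesis
    by (simp add: total_degree3_def)
next
  case False
  then obtain i j k where "coeff (coeff (coeff p k) j) i \<noteq> 0"
    by (metis leading_coeff_0_iff)
  then have "{i + j + k |i j k. coeff (coeff (coeff p k) j) i \<noteq> 0} = {n}"
    using assms unfolding homogeneous_def by blast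
  with False show ?thesis
    by (simp add: total_degree3_def)
qed

fun scale :: "poly3 \<Rightarrow> projmap \<Rightarrow> projmap" where
  "scale t (p, q, r) = (t * p, t * q, t * r)"

lemma scale_scale: "scale s (scale t v) = scale (s * t) v"
  by (cases v) (simp add: mult.assoc)

text \<open>The gcd of the components recovers the common factor \<open>t\<close> up to a constant, and constants do
  not affect degrees.\<close>

lemma proj_degree_scale:
  assumes t: "t \<noteq> 0"
    and hom: "homogeneous d p" "homogeneous d q" "homogeneous d r"
    and nonzero: "p \<noteq> 0"
    and reduced: "\<And>\<pi>. prime \<pi> \<Longrightarrow> \<pi> dvd p \<Longrightarrow> \<pi> dvd q \<Longrightarrow> \<pi> dvd r \<Longrightarrow> False"
  shows "proj_degree (scale t (p, q, r)) = d"
proof -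
  have "coprime p (gcd q r)"
    using nonzero by (rule coprime_if_no_common_prime) (auto intro: reduced)
  then have "gcd p (gcd q r) = 1"
    by (rule coprime_imp_gcd_eq_1)
  then have gcd_eq: "gcd (t * p) (gcd (t * q) (t * r)) = normalize t"
    by (simp add: gcd_mult_left)
  obtain c where c: "unit_factor t = const3 c" "c \<noteq> 0"
    using unit_poly3_eq_const3 t unit_factor_is_unit by metis
  have quotient: "t * s div normalize t = const3 c * s" for s
  proof -
    have "t * s = normalize t * (unit_factor t * s)"
      by (metis mult.assoc normalize_mult_unit_factor)
    then show ?thesis
      using t c(1) by (metis nonzero_mult_div_cancel_left normalize_eq_0_iff)
  qed
  have degree: "total_degree3 (const3 c * s) = (if s = 0 then 0 else d)" if "homogeneous d s" for s
    using total_degree3_homogeneous[OF homogeneous_const3_mult[OF that]] c(2) by simp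
  show ?thesis
    using nonzero by (simp add: proj_degree_def gcd_eq quotient degree hom)
qed


section \<open>Iterating a map of the family\<close>

text \<open>Substitution consists of three nested Horner evaluations, each of which preserves sums and
  products if the map applied to the coefficients does.\<close>

lemma poly_map_poly_add:
  assumes "h 0 = 0" "\<And>a b. h (a + b) = h a + h b"
  shows "poly (map_poly h (p + q)) x = poly (map_poly h p) x + poly (map_poly h q) x"
  by (induction p q rule: poly_induct2) (simp_all add: map_poly_pCons assms algebra_simps)

lemma poly_map_poly_mult:
  assumes h: "h 0 = 0" "\<And>a b. h (a + b) = h a + h b" "\<And>a b. h (a * b) = h a * h b"
  shows "poly (map_poly h (p * q)) x = poly (map_poly h p) x * poly (map_poly h q) x"
proof (induction p)
  case 0
  show ?case by simp
next
  case (pCons a p)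
  have "poly (map_poly h (smult a q)) x = h a * poly (map_poly h q) x"
    by (induction q) (simp_all add: map_poly_pCons h algebra_simps)
  with pCons show ?case
    by (simp add: map_poly_pCons poly_map_poly_add h algebra_simps)
qed

lemma subst3_add: "subst3 (p + q) v = subst3 p v + subst3 q v"
  and subst3_mult: "subst3 (p * q) v = subst3 p v * subst3 q v"
  unfolding subst3_def
  by (cases v; simp add: poly_map_poly_add poly_map_poly_mult const3_add const3_mult)+

lemma subst3_const3 [simp]: "subst3 (const3 c) v = const3 c"
  and subst3_X0 [simp]: "subst3 X0 (q0, q1, q2) = q0"
  and subst3_X1 [simp]: "subst3 X1 (q0, q1, q2) = q1"
  and subst3_X2 [simp]: "subst3 X2 (q0, q1, q2) = q2"
  unfolding subst3_def
     apply (cases v, simp add: const3_def map_poly_pCons)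
    apply (simp_all add: X0_def X1_def X2_def map_poly_pCons)
  done

definition linear_form :: "(nat \<Rightarrow> complex) \<Rightarrow> projmap \<Rightarrow> poly3" where
  "linear_form v = (\<lambda>(q0, q1, q2). const3 (v 0) * q0 + const3 (v 1) * q1 + const3 (v 2) * q2)"

lemma linear_form_X: "linear_form v (X0, X1, X2) = linear3 v"
  by (simp add: linear_form_def linear3_def)

lemma linear_form_scale: "linear_form v (scale t q) = t * linear_form v q"
  by (cases q) (simp add: linear_form_def algebra_simps)

lemma proj_comp_proj_map:
  "proj_comp (proj_map \<alpha> \<beta> \<gamma>) q =
    (fst q * linear_form \<gamma> q, linear_form \<alpha> q * linear_form \<gamma> q, fst q * linear_form \<beta> q)"
  by (cases q) (simp add: proj_comp_def proj_map_def linear3_def linear_form_def subst3_add subst3_mult)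

lemma proj_comp_scale:
  "proj_comp (proj_map \<alpha> \<beta> \<gamma>) (scale t q) = scale (t * t) (proj_comp (proj_map \<alpha> \<beta> \<gamma>) q)"
  by (cases q) (simp add: proj_comp_proj_map linear_form_scale[of _ _ "(_, _, _)", simplified])

lemma proj_iter_0: "proj_iter F 0 = (X0, X1, X2)"
  and proj_iter_Suc: "proj_iter F (Suc n) = proj_comp F (proj_iter F n)"
  by (simp_all add: proj_iter_def)

lemma X0_nonzero [simp]: "X0 \<noteq> 0"
  by (simp add: X0_def)

text \<open>Such a prime would not involve \<open>x\<^sub>1\<close> and \<open>x\<^sub>2\<close>, hence would divide every coefficient of
  \<open>p\<close> with respect to \<open>x\<^sub>1\<close> and \<open>x\<^sub>2\<close>, but one of these is a nonzero constant.\<close>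

lemma no_prime_dvd_X0_and:
  assumes "prime \<pi>" "\<pi> dvd X0" "\<pi> dvd p" "coeff (coeff p k) j = [:c:]" "c \<noteq> 0"
  shows False
proof -
  have "\<pi> dvd [:coeff p k:]"
    using assms(2,3) by (intro dvd_coeff_if_dvd_const) (auto simp: X0_def)
  moreover obtain \<rho> where \<rho>: "\<pi> = [:\<rho>:]" "\<rho> dvd [:[:0, 1:]:]"
  proof -
    have "degree \<pi> = 0"
      using dvd_imp_degree_le[OF assms(2)] by (simp add: X0_def)
    then obtain \<rho> where "\<pi> = [:\<rho>:]"
      by (elim degree_eq_zeroE)
    with assms(2) that show thesis
      by (simp add: X0_def)
  qed
  ultimately have "\<rho> dvd [:coeff (coeff p k) j:]"
    by (intro dvd_coeff_if_dvd_const) auto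
  then have "\<pi> dvd const3 c"
    by (simp add: \<rho> const3_def assms(4))
  with assms(1,5) show False
    by (simp add: prime_not_dvd_const3)
qed

text \<open>On an irreducible curve other than the line at infinity, the affine coordinates
  \<open>x\<^sub>1/x\<^sub>0\<close> and \<open>x\<^sub>2/x\<^sub>0\<close> cannot both be constant.\<close>

lemma affine_coordinates_nonconstant:
  assumes "prime \<pi>" "\<pi> dvd X1 - const3 c * X0" "\<pi> dvd X2 - const3 d * X0"
  shows False
proof -
  have "\<pi> dvd [:coeff (X2 - const3 d * X0) 1:]"
    using assms(2,3) by (intro dvd_coeff_if_dvd_const) (auto simp: X0_def X1_def const3_def)
  then have "\<pi> dvd 1"
    by (simp add: X0_def X2_def const3_def one_pCons)
  with assms(1) show False
    using not_prime_unit by blast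
qed

lemma proj_degree_iter_0: "proj_degree (proj_iter F 0) = 1"
proof -
  have "proj_degree (scale 1 (X0, X1, X2)) = 1"
  proof (rule proj_degree_scale)
    fix \<pi> assume "prime \<pi>" "\<pi> dvd X0" "\<pi> dvd X1"
    then show False
      by (rule no_prime_dvd_X0_and[where k = 0 and j = 1 and c = 1]) (simp_all add: X1_def)
  qed (use homogeneous_X0 homogeneous_X1 homogeneous_X2 in auto)
  then show ?thesis
    by (simp add: proj_iter_0)
qed


section \<open>Consequences of birationality\<close>

lemma nonzero_eval2:
  assumes "q \<noteq> 0"
  shows "\<exists>z. eval2 q z \<noteq> 0"
proof -
  have "infinite (range (\<lambda>y :: complex. [:y:]))"
    by (subst finite_image_iff) (auto simp: inj_def infinite_UNIV_char_0)
  then have "\<not> range (\<lambda>y. [:y:]) \<subseteq> {r. poly q r = 0}"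
    using poly_roots_finite[OF assms] finite_subset by blast
  then obtain y where "poly q [:y:] \<noteq> 0"
    by auto
  then obtain x where "poly (poly q [:y:]) x \<noteq> 0"
    using poly_all_0_iff_0 by blast
  then have "eval2 q (x, y) \<noteq> 0"
    by (simp add: eval2_def)
  then show ?thesis ..
qed

text \<open>Off a curve, every point is a value of a birational map, so its values cannot all satisfy a
  nontrivial polynomial equation.\<close>

lemma birational_image_not_in_curve:
  assumes "birational f" "q \<noteq> 0"
  shows "\<exists>z \<in> ratmap_dom f. eval2 q (ratmap_apply f z) \<noteq> 0"
proof -
  obtain V g where V: "algebraic_curve V"
    and g: "\<And>z. z \<notin> V \<Longrightarrow>
      ratmap_apply g z \<in> ratmap_dom f \<and> ratmap_apply f (ratmap_apply g z) = z"
    using assms(1) unfolding birational_def by metis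
  obtain p where p: "\<nexists>c. p = [:[:c:]:]" "V = {z. eval2 p z = 0}"
    using V by (auto simp: algebraic_curve_def)
  from p(1) have "p \<noteq> 0"
    by (metis pCons_0_0)
  with assms(2) obtain z where "eval2 (q * p) z \<noteq> 0"
    using nonzero_eval2[of "q * p"] by auto
  then have "eval2 q z \<noteq> 0" "z \<notin> V"
    by (auto simp: eval2_def p(2))
  with g show ?thesis
    by metis
qed

lemma proportional:
  fixes u v :: "nat \<Rightarrow> complex"
  assumes "(v 1, v 2) \<noteq> (0, 0)" "u 1 * v 2 - u 2 * v 1 = 0"
  obtains c where "u 1 = c * v 1" "u 2 = c * v 2"
proof (cases "v 2 = 0")
  case True
  then show ?thesis
    using assms that[of "u 1 / v 1"] by auto
next
  case False
  then show ?thesis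
    using assms that[of "u 2 / v 2"] by (auto simp: field_simps)
qed

lemma eval2_affine2: "eval2 (affine2 v) (x, y) = v 0 + v 1 * x + v 2 * y"
  by (simp add: eval2_def affine2_def algebra_simps)

text \<open>If \<open>(\<alpha>\<^sub>1, \<alpha>\<^sub>2) = 0\<close> then the image lies on a vertical line; if \<open>(\<beta>\<^sub>1, \<beta>\<^sub>2)\<close> and
  \<open>(\<alpha>\<^sub>1, \<alpha>\<^sub>2)\<close> are both multiples of \<open>(\<gamma>\<^sub>1, \<gamma>\<^sub>2)\<close> then both components depend only on the
  denominator, and the image lies on a conic.\<close>

lemma birational_nondegenerate:
  assumes \<gamma>: "(\<gamma> 1, \<gamma> 2) \<noteq> (0, 0)"
    and birational: "birational (plane_map \<alpha> \<beta> \<gamma>)"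
    and \<alpha>: "\<alpha> 1 * \<gamma> 2 - \<alpha> 2 * \<gamma> 1 = 0"
  obtains \<kappa> where "\<kappa> \<noteq> 0" "\<alpha> 1 = \<kappa> * \<gamma> 1" "\<alpha> 2 = \<kappa> * \<gamma> 2"
    "\<beta> 1 * \<gamma> 2 - \<beta> 2 * \<gamma> 1 \<noteq> 0"
proof -
  obtain \<kappa> where \<kappa>: "\<alpha> 1 = \<kappa> * \<gamma> 1" "\<alpha> 2 = \<kappa> * \<gamma> 2"
    using proportional[OF \<gamma> \<alpha>] .
  have image: "ratmap_apply (plane_map \<alpha> \<beta> \<gamma>) (x, y) =
      (\<alpha> 0 + \<alpha> 1 * x + \<alpha> 2 * y, (\<beta> 0 + \<beta> 1 * x + \<beta> 2 * y) / (\<gamma> 0 + \<gamma> 1 * x + \<gamma> 2 * y))" for x y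
    unfolding ratmap_apply_def plane_map_def by (simp add: eval2_affine2) (simp add: eval2_def)
  have domain: "(x, y) \<in> ratmap_dom (plane_map \<alpha> \<beta> \<gamma>) \<longleftrightarrow> \<gamma> 0 + \<gamma> 1 * x + \<gamma> 2 * y \<noteq> 0" for x y
    unfolding ratmap_dom_def plane_map_def by (simp add: eval2_affine2) (simp add: eval2_def)
  have "\<kappa> \<noteq> 0"
  proof
    assume "\<kappa> = 0"
    then have "eval2 [:[:- \<alpha> 0, 1:]:] (ratmap_apply (plane_map \<alpha> \<beta> \<gamma>) z) = 0" for z
      by (cases z) (simp add: image \<kappa>[unfolded One_nat_def] eval2_def)
    then show False
      using birational_image_not_in_curve[OF birational, of "[:[:- \<alpha> 0, 1:]:]"] by simp
  qed
  moreover have "\<beta> 1 * \<gamma> 2 - \<beta> 2 * \<gamma> 1 \<noteq> 0"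
  proof
    assume "\<beta> 1 * \<gamma> 2 - \<beta> 2 * \<gamma> 1 = 0"
    then obtain \<mu> where \<mu>: "\<beta> 1 = \<mu> * \<gamma> 1" "\<beta> 2 = \<mu> * \<gamma> 2"
      using proportional[OF \<gamma>] by blast
    \<comment> \<open>With \<open>w\<close> the denominator, the map is \<open>(s + \<kappa> w, \<mu> + t / w)\<close>, on the conic
      \<open>(x - s) (y - \<mu>) = \<kappa> t\<close>.\<close>
    define s where "s = \<alpha> 0 - \<kappa> * \<gamma> 0"
    define t where "t = \<beta> 0 - \<mu> * \<gamma> 0"
    define q where "q = [:[:s * \<mu> - \<kappa> * t, - \<mu>:], [:- s, 1:]:]"
    have "eval2 q (ratmap_apply (plane_map \<alpha> \<beta> \<gamma>) z) = 0" if "z \<in> ratmap_dom (plane_map \<alpha> \<beta> \<gamma>)" for z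
    proof -
      obtain x y where z: "z = (x, y)"
        by (cases z)
      define w where "w = \<gamma> 0 + \<gamma> 1 * x + \<gamma> 2 * y"
      have "w \<noteq> 0"
        using that by (simp add: z domain w_def)
      have "\<alpha> 0 + \<alpha> 1 * x + \<alpha> 2 * y = s + \<kappa> * w" "\<beta> 0 + \<beta> 1 * x + \<beta> 2 * y = t + \<mu> * w"
        unfolding s_def t_def w_def \<kappa> \<mu> by (simp_all add: algebra_simps)
      then have "ratmap_apply (plane_map \<alpha> \<beta> \<gamma>) z = (s + \<kappa> * w, (t + \<mu> * w) / w)"
        unfolding z image w_def by (simp only:)
      moreover have "eval2 q (a, b) = (a - s) * (b - \<mu>) - \<kappa> * t" for a b
        by (simp add: q_def eval2_def algebra_simps)
      moreover have "(t + \<mu> * w) / w - \<mu> = t / w"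
        using \<open>w \<noteq> 0\<close> by (simp add: add_divide_distrib)
      ultimately show ?thesis
        using \<open>w \<noteq> 0\<close> by simp
    qed
    moreover have "q \<noteq> 0"
      by (simp add: q_def)
    ultimately show False
      using birational_image_not_in_curve[OF birational, of q] by blast
  qed
  ultimately show thesis
    using that \<kappa> by blast
qed

section \<open>Reduction to a second-order recurrence\<close>

locale proportional_map =
  fixes \<alpha> \<beta> \<gamma> :: "nat \<Rightarrow> complex" and \<kappa> :: complex
  assumes \<gamma>_2: "\<gamma> 2 \<noteq> 0"
    and \<kappa>: "\<kappa> \<noteq> 0"
    and \<alpha>_1: "\<alpha> 1 = \<kappa> * \<gamma> 1"
    and \<alpha>_2: "\<alpha> 2 = \<kappa> * \<gamma> 2"
    and determinant: "\<beta> 1 * \<gamma> 2 - \<beta> 2 * \<gamma> 1 \<noteq> 0"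
begin

text \<open>\<open>x\<^sub>1 = \<kappa> w + shift\<close> holds when \<open>w\<close> is the previous value of the denominator. The other four
  numbers are the coefficients of the recurrence
  \<open>w\<^sub>n\<^sub>+\<^sub>1 w\<^sub>n = a w\<^sub>n\<^sup>2 + b w\<^sub>n + c + e w\<^sub>n\<^sub>-\<^sub>1\<close>, in this order.\<close>

definition shift :: complex where
  "shift = \<alpha> 0 - \<kappa> * \<gamma> 0"

definition quadratic_coeff :: complex where
  "quadratic_coeff = \<alpha> 1"

definition linear_coeff :: complex where
  "linear_coeff = \<gamma> 0 + \<gamma> 1 * shift + \<beta> 2"

definition constant_coeff :: complex where
  "constant_coeff = \<gamma> 2 * \<beta> 0 + (\<beta> 1 * \<gamma> 2 - \<beta> 2 * \<gamma> 1) * shift - \<beta> 2 * \<gamma> 0"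

definition delay_coeff :: complex where
  "delay_coeff = \<kappa> * (\<beta> 1 * \<gamma> 2 - \<beta> 2 * \<gamma> 1)"

lemma delay_coeff_nonzero: "delay_coeff \<noteq> 0"
  using \<kappa> determinant by (simp add: delay_coeff_def)

text \<open>The linear change of coordinates that recovers \<open>(x\<^sub>1, x\<^sub>2)\<close> from the previous value \<open>U/E\<close> and
  the current value \<open>W/E\<close> of the denominator.\<close>

fun coord :: "projmap \<Rightarrow> projmap" where
  "coord (E, U, W) = (E, const3 \<kappa> * U + const3 shift * E,
    const3 (1 / \<gamma> 2) * (W - const3 (\<gamma> 0) * E - const3 (\<gamma> 1) * (const3 \<kappa> * U + const3 shift * E)))"

definition next_numerator :: "poly3 \<Rightarrow> poly3 \<Rightarrow> poly3 \<Rightarrow> poly3" where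
  "next_numerator E U W = const3 quadratic_coeff * W * W + const3 linear_coeff * W * E +
    const3 constant_coeff * E * E + const3 delay_coeff * U * E"

fun recurrence :: "projmap \<Rightarrow> projmap" where
  "recurrence (E, U, W) = (E * W, W * W, next_numerator E U W)"

lemma coord_scale: "coord (scale t v) = scale t (coord v)"
  by (cases v) (simp add: algebra_simps)

lemma linear_form_\<gamma>_coord: "linear_form \<gamma> (coord (E, U, W)) = W"
proof -
  show ?thesis
    unfolding linear_form_def coord.simps prod.case using const3_inverse[OF \<gamma>_2] by algebra
qed

lemma linear_form_\<alpha>_coord: "linear_form \<alpha> (coord (E, U, W)) = const3 \<kappa> * W + const3 shift * E"
proof -
  have "linear_form \<alpha> v = const3 \<kappa> * linear_form \<gamma> v + const3 shift * fst v" for v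
    unfolding linear_form_def \<alpha>_1 \<alpha>_2 shift_def const3_mult const3_diff
    by (cases v) (simp add: algebra_simps)
  then show ?thesis
    by (simp only: linear_form_\<gamma>_coord) simp
qed

text \<open>No factor is lost here: the two homogeneous maps are conjugate as polynomial triples, so
  common factors may be studied on either side.\<close>

lemma proj_comp_coord: "proj_comp (proj_map \<alpha> \<beta> \<gamma>) (coord v) = coord (recurrence v)"
proof -
  obtain E U W where v: "v = (E, U, W)"
    by (cases v)
  define r where "r = const3 (1 / \<gamma> 2)"
  have "r * const3 (\<gamma> 2) = 1"
    using const3_inverse[OF \<gamma>_2] by (simp add: r_def mult.commute)
  then have "E * linear_form \<beta> (coord (E, U, W)) = snd (snd (coord (recurrence (E, U, W))))"
    unfolding coord.simps recurrence.simps linear_form_def next_numerator_def r_def[symmetric]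
      quadratic_coeff_def linear_coeff_def constant_coeff_def delay_coeff_def \<alpha>_1
      const3_add const3_mult const3_diff prod.case snd_conv
    by algebra
  then show ?thesis
    by (simp add: v proj_comp_proj_map linear_form_\<gamma>_coord linear_form_\<alpha>_coord algebra_simps
        del: coord.simps) (simp add: algebra_simps)
qed

text \<open>The identity map in the new coordinates; its second component stands for the value that the
  denominator would have had one step before the orbit starts.\<close>

definition start :: projmap where
  "start = (X0, const3 (1 / \<kappa>) * (X1 - const3 shift * X0), linear3 \<gamma>)"

lemma coord_start: "coord start = (X0, X1, X2)"
proof -
  have c: "const3 \<kappa> * (const3 (1 / \<kappa>) * p) = p" "const3 (\<gamma> 2) * (const3 (1 / \<gamma> 2) * p) = p"
    "const3 (1 / \<gamma> 2) * (const3 (\<gamma> 2) * p) = p" for p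
    using const3_inverse[OF \<kappa>] const3_inverse[OF \<gamma>_2] by algebra+
  show ?thesis
    by (simp add: start_def linear3_def c)
qed

lemma proj_iter_Suc_coord:
  assumes "proj_iter (proj_map \<alpha> \<beta> \<gamma>) n = scale T (coord v)"
    and "recurrence v = scale t v'"
  shows "proj_iter (proj_map \<alpha> \<beta> \<gamma>) (Suc n) = scale (T * T * t) (coord v')"
  by (simp add: proj_iter_Suc assms proj_comp_scale proj_comp_coord coord_scale scale_scale)

lemma proj_degree_coord:
  assumes "T \<noteq> 0" "E \<noteq> 0"
    and hom: "homogeneous d E" "homogeneous d U" "homogeneous d W"
    and reduced: "\<And>\<pi>. prime \<pi> \<Longrightarrow> \<pi> dvd E \<Longrightarrow> \<pi> dvd U \<Longrightarrow> \<pi> dvd W \<Longrightarrow> False"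
  shows "proj_degree (scale T (coord (E, U, W))) = d"
  unfolding coord.simps
proof (rule proj_degree_scale)
  let ?x1 = "const3 \<kappa> * U + const3 shift * E"
  fix \<pi>
  assume \<pi>: "prime \<pi>" "\<pi> dvd E" "\<pi> dvd ?x1"
    "\<pi> dvd const3 (1 / \<gamma> 2) * (W - const3 (\<gamma> 0) * E - const3 (\<gamma> 1) * ?x1)"
  have "\<pi> dvd const3 \<kappa> * U"
    using \<pi>(2,3) by (simp add: dvd_add_left_iff)
  then have "\<pi> dvd U"
    using \<pi>(1) \<kappa> by (simp add: prime_dvd_const3_mult_iff)
  have "\<pi> dvd W - const3 (\<gamma> 0) * E - const3 (\<gamma> 1) * ?x1"
    using \<pi>(1,4) \<gamma>_2 by (subst (asm) prime_dvd_const3_mult_iff) auto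
  then have "\<pi> dvd W - const3 (\<gamma> 0) * E - const3 (\<gamma> 1) * ?x1 + const3 (\<gamma> 0) * E + const3 (\<gamma> 1) * ?x1"
    using \<pi>(2,3) by (intro dvd_add) (simp_all add: dvd_mult)
  then have "\<pi> dvd W"
    by simp
  with \<open>\<pi> dvd U\<close> \<pi>(1,2) show False
    using reduced by blast
qed (use assms in \<open>auto intro!: homogeneous_add homogeneous_diff homogeneous_const3_mult\<close>)


section \<open>Contracted curves\<close>

text \<open>The irreducible curve \<open>\<pi> = 0\<close> is not mapped into the line at infinity and is contracted to the
  finite point \<open>(u, w)\<close>.\<close>

definition constant_along :: "poly3 \<Rightarrow> projmap \<Rightarrow> bool" where
  "constant_along \<pi> = (\<lambda>(E, U, W). \<not> \<pi> dvd E \<and>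
    (\<exists>u w. \<pi> dvd U - const3 u * E \<and> \<pi> dvd W - const3 w * E))"

text \<open>Modulo \<open>\<pi>\<close>, the current value at time \<open>n\<close> is the previous value \<open>u\<close> at time \<open>n + 1\<close>, and the
  previous value at time \<open>n\<close> is obtained by solving the recurrence for its delayed term, which is
  possible because \<open>e\<close> is invertible. The divisibility \<open>t dvd E'\<close> ensures that \<open>\<pi>\<close> is not among the
  cancelled factors.\<close>

lemma constant_along_pullback:
  assumes \<pi>: "prime \<pi>"
    and eq: "recurrence (E, U, W) = scale t (E', U', W')"
    and t: "t dvd E'"
    and const: "constant_along \<pi> (E', U', W')"
  shows "constant_along \<pi> (E, U, W)"
proof -
  obtain u w where \<pi>': "\<not> \<pi> dvd E'" "\<pi> dvd U' - const3 u * E'" "\<pi> dvd W' - const3 w * E'"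
    using const by (auto simp: constant_along_def)
  have eq: "E * W = t * E'" "W * W = t * U'" "next_numerator E U W = t * W'"
    using eq by simp_all
  have "\<not> \<pi> dvd t"
    using \<pi>'(1) t dvd_trans by blast
  then have "\<not> \<pi> dvd E * W"
    using \<pi> \<pi>'(1) by (simp add: eq prime_dvd_mult_iff)
  then have E: "\<not> \<pi> dvd E" and W: "\<not> \<pi> dvd W"
    by auto
  have "W * (W - const3 u * E) = t * (U' - const3 u * E')"
    using eq by algebra
  with \<pi>'(2) have "\<pi> dvd W * (W - const3 u * E)"
    by simp
  with \<pi> W have Wu: "\<pi> dvd W - const3 u * E"
    by (simp add: prime_dvd_mult_iff)
  \<comment> \<open>The previous value \<open>- r / e\<close> solves \<open>w u = a u\<^sup>2 + b u + c + e x\<close> for \<open>x\<close>.\<close>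
  define r where "r = quadratic_coeff * u * u + linear_coeff * u + constant_coeff - w * u"
  define e where "e = delay_coeff"
  have "E * (const3 e * (U - const3 (- r / e) * E)) = E * (const3 e * U + const3 r * E)"
    using const3_mult[of e "- r / e"] delay_coeff_nonzero
    by (simp add: e_def algebra_simps const3_uminus)
  also have "\<dots> = t * (W' - const3 w * E') - (W - const3 u * E) *
      (const3 quadratic_coeff * W + const3 quadratic_coeff * const3 u * E +
       const3 linear_coeff * E - const3 w * E)"
    using eq unfolding r_def e_def next_numerator_def const3_add const3_diff const3_mult by algebra
  also have "\<pi> dvd \<dots>"
    using \<pi>'(3) Wu by (intro dvd_diff) simp_all
  finally have "\<pi> dvd U - const3 (- r / e) * E"
    using \<pi> E prime_not_dvd_const3[OF \<pi> delay_coeff_nonzero]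
    by (simp add: prime_dvd_mult_iff e_def)
  with E Wu show ?thesis
    by (auto simp: constant_along_def)
qed

lemma not_constant_along_start:
  assumes "prime \<pi>"
  shows "\<not> constant_along \<pi> start"
proof
  assume "constant_along \<pi> start"
  then obtain u w where u: "\<pi> dvd const3 (1 / \<kappa>) * (X1 - const3 shift * X0) - const3 u * X0"
    and w: "\<pi> dvd linear3 \<gamma> - const3 w * X0"
    by (auto simp: constant_along_def start_def)
  define x y where "x = \<kappa> * u + shift" and "y = (w - \<gamma> 0 - \<gamma> 1 * x) / \<gamma> 2"
  have "X1 - const3 x * X0 = const3 \<kappa> * (const3 (1 / \<kappa>) * (X1 - const3 shift * X0) - const3 u * X0)"
    using const3_inverse[OF \<kappa>] unfolding x_def const3_add const3_mult by algebra
  with u have x: "\<pi> dvd X1 - const3 x * X0"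
    by simp
  have "w = \<gamma> 0 + \<gamma> 1 * x + \<gamma> 2 * y"
    using \<gamma>_2 by (simp add: y_def)
  then have "const3 (\<gamma> 2) * (X2 - const3 y * X0) =
      (linear3 \<gamma> - const3 w * X0) - const3 (\<gamma> 1) * (X1 - const3 x * X0)"
    by (simp add: linear3_def const3_add const3_mult algebra_simps)
  also have "\<pi> dvd \<dots>"
    using w x dvd_diff dvd_mult by blast
  finally have "\<pi> dvd X2 - const3 y * X0"
    using assms \<gamma>_2 by (simp add: prime_dvd_const3_mult_iff)
  with assms x show False
    by (rule affine_coordinates_nonconstant)
qed


text \<open>The map is indeterminate at the finite point \<open>(- c / e, 0)\<close>, where numerator and denominator of
  the next value vanish together. A prime satisfying both equations must therefore lie at
  infinity unless it contracts its curve to that point.\<close>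

lemma prime_dvd_of_indeterminate:
  assumes "prime \<pi>" "\<not> constant_along \<pi> (E, U, W)"
    and "\<pi> dvd W" "\<pi> dvd const3 constant_coeff * E + const3 delay_coeff * U"
  shows "\<pi> dvd E"
proof -
  define u where "u = - constant_coeff / delay_coeff"
  have "constant_coeff = - (delay_coeff * u)"
    using delay_coeff_nonzero by (simp add: u_def)
  then have "const3 constant_coeff * E + const3 delay_coeff * U = const3 delay_coeff * (U - const3 u * E)"
    by (simp add: const3_uminus const3_mult algebra_simps)
  with assms have "\<pi> dvd U - const3 u * E"
    using delay_coeff_nonzero by (simp add: prime_dvd_const3_mult_iff)
  moreover have "\<pi> dvd W - const3 0 * E"
    using assms(3) by simp
  ultimately show ?thesis
    using assms(2) unfolding constant_along_def by blast
qed

lemma homogeneous_next_numerator: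
  assumes "homogeneous d E" "homogeneous d U" "homogeneous d W"
  shows "homogeneous (d + d) (next_numerator E U W)"
  using assms unfolding next_numerator_def
  by (intro homogeneous_add homogeneous_mult homogeneous_const3_mult)

lemma homogeneous_start_delay: "homogeneous 1 (const3 (1 / \<kappa>) * (X1 - const3 shift * X0))"
  by (intro homogeneous_const3_mult homogeneous_diff homogeneous_X0 homogeneous_X1)

lemma coprime_X0_linear3: "coprime X0 (linear3 \<gamma>)"
proof (rule coprime_if_no_common_prime)
  fix \<pi>
  assume "prime \<pi>" "\<pi> dvd X0" "\<pi> dvd linear3 \<gamma>"
  then show False
    by (rule no_prime_dvd_X0_and[where k = 1 and j = 0 and c = "\<gamma> 2"])
      (simp_all add: linear3_def const3_def X0_def X1_def X2_def \<gamma>_2)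
qed simp


section \<open>Nonzero quadratic coefficient: no cancellation\<close>

definition state :: "nat \<Rightarrow> projmap" where
  "state n = (recurrence ^^ n) start"

lemma state_0: "state 0 = start"
  and state_Suc: "state (Suc n) = recurrence (state n)"
  by (simp_all add: state_def)

lemma proj_iter_state: "proj_iter (proj_map \<alpha> \<beta> \<gamma>) n = scale 1 (coord (state n))"
proof (induction n)
  case 0
  show ?case
    by (simp add: proj_iter_0 state_0 coord_start)
next
  case (Suc n)
  have "recurrence (state n) = scale 1 (state (Suc n))"
    by (cases "state (Suc n)") (simp add: state_Suc)
  from proj_iter_Suc_coord[OF Suc this] show ?case
    by simp
qed

lemma not_constant_along_state:
  assumes "prime \<pi>"
  shows "\<not> constant_along \<pi> (state n)"
proof (induction n)
  case 0
  show ?case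
    using not_constant_along_start[OF assms] by (simp add: state_0)
next
  case (Suc n)
  obtain E U W where s: "state n = (E, U, W)"
    by (cases "state n")
  obtain E' U' W' where s': "state (Suc n) = (E', U', W')"
    by (cases "state (Suc n)")
  have "recurrence (E, U, W) = scale 1 (E', U', W')"
    using state_Suc[of n] unfolding s s' by simp
  from constant_along_pullback[OF assms this] Suc show ?case
    unfolding s s' by auto
qed

text \<open>Divisibility of \<open>E\<close> by \<open>x\<^sub>0\<close> is carried along because it makes \<open>E\<close> a non-unit, so that
  coprimality forces \<open>W \<noteq> 0\<close>. Modulo a prime factor of \<open>E\<close> the next numerator is \<open>a W\<^sup>2\<close>, so such
  a prime is excluded by \<open>a \<noteq> 0\<close> and the coprimality of \<open>E\<close> and \<open>W\<close>; a prime factor of \<open>W\<close> would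
  have to contract its curve to the indeterminate point.\<close>

lemma state_reduced:
  assumes "quadratic_coeff \<noteq> 0" "state n = (E, U, W)"
  shows "E \<noteq> 0 \<and> X0 dvd E \<and> coprime E W \<and>
    homogeneous (2 ^ n) E \<and> homogeneous (2 ^ n) U \<and> homogeneous (2 ^ n) W"
  using assms(2)
proof (induction n arbitrary: E U W)
  case 0
  then show ?case
    using homogeneous_X0 homogeneous_start_delay homogeneous_linear3 coprime_X0_linear3
    by (auto simp: state_0 start_def)
next
  case (Suc n)
  obtain E\<^sub>0 U\<^sub>0 W\<^sub>0 where s: "state n = (E\<^sub>0, U\<^sub>0, W\<^sub>0)"
    by (cases "state n")
  have eq: "E = E\<^sub>0 * W\<^sub>0" "U = W\<^sub>0 * W\<^sub>0" "W = next_numerator E\<^sub>0 U\<^sub>0 W\<^sub>0"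
    using Suc.prems by (simp_all add: state_Suc s)
  note IH = Suc.IH[OF s]
  have "\<not> is_unit X0"
    by (simp add: X0_def is_unit_poly_iff)
  with IH have "\<not> is_unit E\<^sub>0"
    using dvd_trans by blast
  with IH have "W\<^sub>0 \<noteq> 0"
    by auto
  have "coprime E W"
  proof (rule coprime_if_no_common_prime)
    show "E \<noteq> 0"
      using IH \<open>W\<^sub>0 \<noteq> 0\<close> by (simp add: eq)
  next
    fix \<pi> assume \<pi>: "prime \<pi>" "\<pi> dvd E" "\<pi> dvd W"
    have not_both: "\<not> (\<pi> dvd E\<^sub>0 \<and> \<pi> dvd W\<^sub>0)"
      using IH \<pi>(1) not_prime_dvd_both by blast
    from \<pi>(1,2) consider "\<pi> dvd E\<^sub>0" | "\<pi> dvd W\<^sub>0" "\<not> \<pi> dvd E\<^sub>0"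
      by (auto simp: eq prime_dvd_mult_iff)
    then show False
    proof cases
      case 1
      have "const3 quadratic_coeff * (W\<^sub>0 * W\<^sub>0) = W - E\<^sub>0 *
          (const3 linear_coeff * W\<^sub>0 + const3 constant_coeff * E\<^sub>0 + const3 delay_coeff * U\<^sub>0)"
        by (simp add: eq next_numerator_def algebra_simps)
      also have "\<pi> dvd \<dots>"
        using \<pi>(3) 1 dvd_diff dvd_mult2 by blast
      finally show False
        using \<pi>(1) assms(1) 1 not_both by (simp add: prime_dvd_mult_iff prime_not_dvd_const3)
    next
      case 2
      have "E\<^sub>0 * (const3 constant_coeff * E\<^sub>0 + const3 delay_coeff * U\<^sub>0) =
          W - W\<^sub>0 * (const3 quadratic_coeff * W\<^sub>0 + const3 linear_coeff * E\<^sub>0)"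
        by (simp add: eq next_numerator_def algebra_simps)
      also have "\<pi> dvd \<dots>"
        using \<pi>(3) 2 dvd_diff dvd_mult2 by blast
      finally have "\<pi> dvd const3 constant_coeff * E\<^sub>0 + const3 delay_coeff * U\<^sub>0"
        using \<pi>(1) 2 by (simp add: prime_dvd_mult_iff)
      then show False
        using prime_dvd_of_indeterminate[OF \<pi>(1) _ 2(1)] not_constant_along_state[OF \<pi>(1), of n] 2(2)
        unfolding s by blast
    qed
  qed
  then show ?case
    using IH \<open>W\<^sub>0 \<noteq> 0\<close> homogeneous_mult[of "2 ^ n" _ "2 ^ n"] homogeneous_next_numerator[of "2 ^ n"]
    by (simp add: eq mult_2)
qed

lemma degree_quadratic:
  assumes "quadratic_coeff \<noteq> 0"
  shows "proj_degree (proj_iter (proj_map \<alpha> \<beta> \<gamma>) n) = 2 ^ n"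
proof -
  obtain E U W where s: "state n = (E, U, W)"
    by (cases "state n")
  show ?thesis
    unfolding proj_iter_state s
  proof (rule proj_degree_coord)
    fix \<pi> assume "prime \<pi>" "\<pi> dvd E" "\<pi> dvd W"
    then show False
      using state_reduced[OF assms s] not_prime_dvd_both by blast
  qed (use state_reduced[OF assms s] in auto)
qed


section \<open>Zero quadratic coefficient: Fibonacci degrees\<close>

text \<open>\<open>num n / den n\<close> is the value of the denominator after \<open>n\<close> steps. The second pair is listed
  separately because at the first step the two fractions involved, both with denominator \<open>x\<^sub>0\<close>, are not
  in the coprime position that the general step assumes.\<close>

fun num den :: "nat \<Rightarrow> poly3" where
  "num 0 = linear3 \<gamma>"
| "num (Suc 0) = const3 linear_coeff * linear3 \<gamma> + const3 constant_coeff * X0 +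
    const3 delay_coeff * (const3 (1 / \<kappa>) * (X1 - const3 shift * X0))"
| "num (Suc (Suc n)) = const3 linear_coeff * num (Suc n) * den n +
    const3 constant_coeff * den (Suc n) * den n + const3 delay_coeff * num n * den (Suc n)"
| "den 0 = X0"
| "den (Suc 0) = linear3 \<gamma>"
| "den (Suc (Suc n)) = den n * num (Suc n)"

text \<open>The index is shifted by one: this is the reduced triple of iterate \<open>n + 1\<close>.\<close>

definition reduced_state :: "nat \<Rightarrow> projmap" where
  "reduced_state n = (den (Suc n) * den n, num n * den (Suc n), num (Suc n) * den n)"

lemma recurrence_start:
  assumes "quadratic_coeff = 0"
  shows "recurrence start = scale 1 (reduced_state 0)"
  using assms by (simp add: start_def reduced_state_def next_numerator_def algebra_simps)

lemma recurrence_reduced_state: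
  assumes "quadratic_coeff = 0"
  shows "recurrence (reduced_state n) = scale (den n) (reduced_state (Suc n))"
  using assms by (simp add: reduced_state_def next_numerator_def algebra_simps)

lemma not_constant_along_reduced_state:
  assumes "quadratic_coeff = 0" "prime \<pi>"
  shows "\<not> constant_along \<pi> (reduced_state n)"
proof (induction n)
  case 0
  have "\<not> constant_along \<pi> start"
    using not_constant_along_start[OF assms(2)] .
  with constant_along_pullback[OF assms(2) recurrence_start[OF assms(1), unfolded start_def reduced_state_def]]
  show ?case
    unfolding start_def reduced_state_def by auto
next
  case (Suc n)
  have "den n dvd den (Suc (Suc n)) * den (Suc n)"
    by simp
  with Suc constant_along_pullback[OF assms(2) recurrence_reduced_state[OF assms(1), unfolded reduced_state_def]]
  show ?case
    unfolding reduced_state_def by blast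
qed

text \<open>Consecutive denominators have to be coprime as well: modulo a prime factor of \<open>den n\<close>,
  \<open>num (n + 2)\<close> is \<open>e * num n * den (n + 1)\<close>. The remaining factor \<open>num (n + 1)\<close> of
  \<open>den (n + 2)\<close> is again treated by the absence of contraction to the indeterminate point.\<close>

lemma num_den_coprime:
  assumes "quadratic_coeff = 0"
  shows "den n \<noteq> 0 \<and> \<not> is_unit (den n) \<and> coprime (num n) (den n) \<and>
    den (Suc n) \<noteq> 0 \<and> \<not> is_unit (den (Suc n)) \<and> coprime (num (Suc n)) (den (Suc n)) \<and>
    coprime (den n) (den (Suc n))"
proof (induction n)
  case 0
  have coeff: "coeff (linear3 \<gamma>) 1 = [:[:\<gamma> 2:]:]"
    by (simp add: linear3_def const3_def X0_def X1_def X2_def)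
  then have "linear3 \<gamma> \<noteq> 0"
    using \<gamma>_2 by auto
  moreover have "\<not> is_unit (linear3 \<gamma>)"
  proof
    assume "is_unit (linear3 \<gamma>)"
    then obtain c where "linear3 \<gamma> = const3 c"
      by (rule unit_poly3_eq_const3)
    with coeff \<gamma>_2 show False
      by (simp add: const3_def)
  qed
  moreover have "\<not> is_unit X0"
    by (simp add: X0_def is_unit_poly_iff)
  moreover have "coprime (linear3 \<gamma>) (num (Suc 0))"
  proof (rule coprime_if_no_common_prime)
    fix \<pi> assume \<pi>: "prime \<pi>" "\<pi> dvd linear3 \<gamma>" "\<pi> dvd num (Suc 0)"
    have "\<pi> dvd const3 constant_coeff * X0 +
        const3 delay_coeff * (const3 (1 / \<kappa>) * (X1 - const3 shift * X0))"
      using \<pi>(2,3) by (simp add: add.assoc dvd_add_right_iff)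
    then have "\<pi> dvd X0"
      using prime_dvd_of_indeterminate[OF \<pi>(1) _ \<pi>(2)] not_constant_along_start[OF \<pi>(1)]
      unfolding start_def by blast
    then show False
      using \<pi> coprime_X0_linear3 not_prime_dvd_both by blast
  qed fact
  ultimately show ?case
    using coprime_X0_linear3 by (simp add: coprime_commute)
next
  case (Suc n)
  let ?D0 = "den n" and ?D1 = "den (Suc n)" and ?N0 = "num n" and ?N1 = "num (Suc n)"
  have N1: "?N1 \<noteq> 0"
    using Suc by auto
  have unit: "\<not> is_unit (den (Suc (Suc n)))"
    using Suc by (simp add: is_unit_mult_iff)
  have "coprime (den (Suc (Suc n))) (num (Suc (Suc n)))"
  proof (rule coprime_if_no_common_prime)
    show "den (Suc (Suc n)) \<noteq> 0"
      using Suc N1 by simp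
  next
    fix \<pi> assume \<pi>: "prime \<pi>" "\<pi> dvd den (Suc (Suc n))" "\<pi> dvd num (Suc (Suc n))"
    have not_both: "\<not> (\<pi> dvd ?N0 \<and> \<pi> dvd ?D0)" "\<not> (\<pi> dvd ?N1 \<and> \<pi> dvd ?D1)"
      "\<not> (\<pi> dvd ?D0 \<and> \<pi> dvd ?D1)"
      using Suc \<pi>(1) not_prime_dvd_both by blast+
    from \<pi>(1,2) consider "\<pi> dvd ?D0" | "\<pi> dvd ?N1" "\<not> \<pi> dvd ?D0"
      by (auto simp: prime_dvd_mult_iff)
    then show False
    proof cases
      case 1
      have "const3 delay_coeff * (?N0 * ?D1) = num (Suc (Suc n)) -
          ?D0 * (const3 linear_coeff * ?N1 + const3 constant_coeff * ?D1)"
        by (simp add: algebra_simps)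
      also have "\<pi> dvd \<dots>"
        using \<pi>(3) 1 dvd_diff dvd_mult2 by blast
      finally show False
        using \<pi>(1) 1 not_both delay_coeff_nonzero
        by (simp add: prime_dvd_mult_iff prime_not_dvd_const3)
    next
      case 2
      have "const3 constant_coeff * (?D1 * ?D0) + const3 delay_coeff * (?N0 * ?D1) =
          num (Suc (Suc n)) - ?N1 * (const3 linear_coeff * ?D0)"
        by (simp add: algebra_simps)
      also have "\<pi> dvd \<dots>"
        using \<pi>(3) 2 dvd_diff dvd_mult2 by blast
      finally have "\<pi> dvd ?D1 * ?D0"
        using prime_dvd_of_indeterminate[OF \<pi>(1), of "?D1 * ?D0" "?N0 * ?D1" "?N1 * ?D0"]
          not_constant_along_reduced_state[OF assms \<pi>(1), of n] 2(1)
        unfolding reduced_state_def by simp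
      then show False
        using \<pi>(1) 2 not_both by (simp add: prime_dvd_mult_iff)
    qed
  qed
  moreover have "coprime ?D1 (den (Suc (Suc n)))"
    using Suc by (simp add: coprime_commute)
  ultimately show ?case
    using Suc N1 unit by (simp add: coprime_commute)
qed

lemma homogeneous_num_den: "homogeneous (fib (n + 1)) (num n) \<and> homogeneous (fib (n + 1)) (den n) \<and>
  homogeneous (fib (n + 2)) (num (n + 1)) \<and> homogeneous (fib (n + 2)) (den (n + 1))"
proof (induction n)
  case 0
  show ?case
    using homogeneous_linear3[of \<gamma>] homogeneous_X0
      homogeneous_add[OF homogeneous_add homogeneous_const3_mult[OF homogeneous_start_delay]]
    by (simp add: homogeneous_const3_mult)
next
  case (Suc n)
  define d\<^sub>0 d\<^sub>1 where d: "d\<^sub>0 = fib (n + 1)" "d\<^sub>1 = fib (n + 2)"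
  have IH: "homogeneous d\<^sub>0 (num n)" "homogeneous d\<^sub>0 (den n)"
    "homogeneous d\<^sub>1 (num (Suc n))" "homogeneous d\<^sub>1 (den (Suc n))"
    using Suc by (simp_all add: d)
  have "homogeneous (d\<^sub>1 + d\<^sub>0) (num (Suc (Suc n)))"
    using homogeneous_mult[OF IH(3) IH(2)] homogeneous_mult[OF IH(4) IH(2)] homogeneous_mult[OF IH(4) IH(1)]
    by (simp add: homogeneous_add homogeneous_const3_mult mult.assoc mult.commute[of "num n"])
  moreover have "homogeneous (d\<^sub>1 + d\<^sub>0) (den (Suc (Suc n)))"
    using homogeneous_mult[OF IH(3) IH(2)] by (simp add: mult.commute)
  ultimately show ?case
    using IH by (simp add: d)
qed

lemma proj_iter_reduced_state:
  assumes "quadratic_coeff = 0"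
  shows "\<exists>T. T \<noteq> 0 \<and> proj_iter (proj_map \<alpha> \<beta> \<gamma>) (Suc n) = scale T (coord (reduced_state n))"
proof (induction n)
  case 0
  have "proj_iter (proj_map \<alpha> \<beta> \<gamma>) 0 = scale 1 (coord start)"
    by (simp add: proj_iter_0 coord_start)
  from proj_iter_Suc_coord[OF this recurrence_start[OF assms]] show ?case
    using one_neq_zero by (metis mult_1)
next
  case (Suc n)
  then obtain T where "T \<noteq> 0"
    "proj_iter (proj_map \<alpha> \<beta> \<gamma>) (Suc n) = scale T (coord (reduced_state n))"
    by blast
  with proj_iter_Suc_coord[OF this(2) recurrence_reduced_state[OF assms]] show ?case
    using num_den_coprime[OF assms, of n] by (intro exI[of _ "T * T * den n"]) simp
qed

lemma degree_fib:
  assumes "quadratic_coeff = 0"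
  shows "proj_degree (proj_iter (proj_map \<alpha> \<beta> \<gamma>) n) = fib (n + 2)"
proof (cases n)
  case 0
  then show ?thesis
    by (simp add: proj_degree_iter_0)
next
  case (Suc m)
  obtain T where T: "T \<noteq> 0" "proj_iter (proj_map \<alpha> \<beta> \<gamma>) n = scale T (coord (reduced_state m))"
    using proj_iter_reduced_state[OF assms] Suc by blast
  note coprime = num_den_coprime[OF assms, of m]
  have deg: "fib (n + 2) = fib (m + 1) + fib (m + 2)"
    by (simp add: Suc)
  have hom: "homogeneous (fib (n + 2)) (den (Suc m) * den m)"
    "homogeneous (fib (n + 2)) (num m * den (Suc m))"
    "homogeneous (fib (n + 2)) (num (Suc m) * den m)"
    using homogeneous_num_den[of m] homogeneous_mult[of "fib (m + 1)" _ "fib (m + 2)"]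
      homogeneous_mult[of "fib (m + 2)" _ "fib (m + 1)"]
    unfolding deg by (simp_all add: add.commute)
  show ?thesis
    unfolding T(2) reduced_state_def
  proof (rule proj_degree_coord)
    fix \<pi>
    assume \<pi>: "prime \<pi>" "\<pi> dvd den (Suc m) * den m" "\<pi> dvd num m * den (Suc m)"
      "\<pi> dvd num (Suc m) * den m"
    have "\<not> (\<pi> dvd num m \<and> \<pi> dvd den m)" "\<not> (\<pi> dvd num (Suc m) \<and> \<pi> dvd den (Suc m))"
      "\<not> (\<pi> dvd den m \<and> \<pi> dvd den (Suc m))"
      using coprime \<pi>(1) not_prime_dvd_both by blast+
    with \<pi> show False
      by (auto simp: prime_dvd_mult_iff simp del: num.simps den.simps)
  qed (use T(1) coprime hom in auto)
qed

end

section \<open>A denominator depending on one variable\<close>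

locale skew_map =
  fixes \<alpha> \<beta> \<gamma> :: "nat \<Rightarrow> complex"
  assumes \<alpha>_2: "\<alpha> 2 = 0" and \<gamma>_2: "\<gamma> 2 = 0"
    and \<alpha>_1: "\<alpha> 1 \<noteq> 0" and \<gamma>_1: "\<gamma> 1 \<noteq> 0" and \<beta>_2: "\<beta> 2 \<noteq> 0"
begin

text \<open>The \<open>n\<close>-th iterate has affine components \<open>base n / x\<^sub>0\<close> and, for positive \<open>n\<close>,
  \<open>fibre_num (n - 1) / poles (n - 1)\<close>; the denominator of the map, evaluated along the orbit after \<open>n\<close>
  steps, is \<open>pole n / x\<^sub>0\<close>.\<close>

fun base :: "nat \<Rightarrow> poly3" where
  "base 0 = X1"
| "base (Suc n) = const3 (\<alpha> 0) * X0 + const3 (\<alpha> 1) * base n"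

definition pole :: "nat \<Rightarrow> poly3" where
  "pole n = const3 (\<gamma> 0) * X0 + const3 (\<gamma> 1) * base n"

definition poles :: "nat \<Rightarrow> poly3" where
  "poles n = (\<Prod>k\<le>n. pole k)"

fun fibre_num :: "nat \<Rightarrow> poly3" where
  "fibre_num 0 = linear3 \<beta>"
| "fibre_num (Suc n) = poles n * (const3 (\<beta> 0) * X0 + const3 (\<beta> 1) * base (Suc n)) +
    const3 (\<beta> 2) * X0 * fibre_num n"

lemma poles_Suc: "poles (Suc n) = poles n * pole (Suc n)"
  by (simp add: poles_def)

lemma coeff_base: "coeff (coeff (base n) 0) 1 = [:\<alpha> 1 ^ n:]"
  by (induction n) (simp_all add: X1_def X0_def const3_def)

lemma coeff_pole: "coeff (coeff (pole n) 0) 1 = [:\<gamma> 1 * \<alpha> 1 ^ n:]"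
  using coeff_base[of n] by (simp add: pole_def X0_def const3_def)

lemma base_constant: "\<exists>r. base n = [:r:]"
proof (induction n)
  case 0
  show ?case
    by (simp add: X1_def)
next
  case (Suc n)
  then show ?case
    by (auto simp: X0_def const3_def)
qed

lemma pole_constant: "\<exists>r. pole n = [:r:]"
  using base_constant[of n] by (auto simp: pole_def X0_def const3_def)

lemma poles_constant: "\<exists>r. poles n = [:r:]"
proof (induction n)
  case 0
  show ?case
    using pole_constant by (simp add: poles_def)
next
  case (Suc n)
  then show ?case
    using pole_constant[of "Suc n"] by (auto simp: poles_Suc)
qed

lemma coeff_fibre_num: "[:coeff (fibre_num n) 1:] = const3 (\<beta> 2) ^ Suc n * X0 ^ n"
proof (induction n)
  case 0
  show ?case
    by (simp add: linear3_def X0_def X1_def X2_def const3_def)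
next
  case (Suc n)
  obtain p b where "poles n = [:p:]" "base (Suc n) = [:b:]"
    using poles_constant[of n] base_constant[of "Suc n"] by blast
  then have "coeff (poles n * (const3 (\<beta> 0) * X0 + const3 (\<beta> 1) * base (Suc n))) 1 = 0"
    by (simp add: X0_def const3_def del: base.simps)
  then have "[:coeff (fibre_num (Suc n)) 1:] = const3 (\<beta> 2) * X0 * [:coeff (fibre_num n) 1:]"
    by (simp add: X0_def const3_def del: base.simps)
  then show ?case
    unfolding Suc by (simp only: power_Suc mult_ac)
qed

lemma pole_nonzero: "pole n \<noteq> 0"
  using coeff_pole[of n] \<alpha>_1 \<gamma>_1 by auto

lemma poles_nonzero: "poles n \<noteq> 0"
  by (simp add: poles_def pole_nonzero)

lemma prime_X0_not_dvd_base:
  assumes "prime \<pi>" "\<pi> dvd X0"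
  shows "\<not> \<pi> dvd base n"
  using no_prime_dvd_X0_and[OF assms _ coeff_base] \<alpha>_1 by auto

lemma prime_X0_not_dvd_poles:
  assumes "prime \<pi>" "\<pi> dvd X0"
  shows "\<not> \<pi> dvd poles n"
proof -
  have "\<not> \<pi> dvd pole k" for k
    using no_prime_dvd_X0_and[OF assms _ coeff_pole] \<alpha>_1 \<gamma>_1 by auto
  then show ?thesis
    using assms(1) by (simp add: poles_def prime_dvd_prod_iff)
qed

text \<open>A prime factor of the poles does not involve \<open>x\<^sub>2\<close>, so it would divide the coefficient of \<open>x\<^sub>2\<close> in
  the numerator, which is a constant times a power of \<open>x\<^sub>0\<close>.\<close>

lemma prime_not_dvd_poles_and_fibre_num:
  assumes "prime \<pi>" "\<pi> dvd poles n" "\<pi> dvd fibre_num n"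
  shows False
proof -
  obtain r where r: "poles n = [:r:]"
    using poles_constant by blast
  then have "r \<noteq> 0"
    using poles_nonzero[of n] by auto
  with assms have "\<pi> dvd [:coeff (fibre_num n) 1:]"
    by (intro dvd_coeff_if_dvd_const) (simp_all add: r)
  then have "\<pi> dvd X0"
    unfolding coeff_fibre_num using assms(1) \<beta>_2 prime_not_dvd_const3
    by (auto simp: prime_dvd_mult_iff dest: prime_dvd_power)
  with assms show False
    using prime_X0_not_dvd_poles by blast
qed

lemma homogeneous_base: "homogeneous 1 (base n)"
  by (induction n) (auto intro!: homogeneous_add homogeneous_const3_mult
      simp: homogeneous_X0[simplified] homogeneous_X1[simplified])

lemma homogeneous_poles: "homogeneous (n + 1) (poles n)"
proof -
  have pole: "homogeneous 1 (pole k)" for k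
    unfolding pole_def
    by (intro homogeneous_add homogeneous_const3_mult homogeneous_X0 homogeneous_base)
  show ?thesis
  proof (induction n)
    case 0
    show ?case
      using pole[of 0] by (simp add: poles_def)
  next
    case (Suc n)
    then show ?case
      using homogeneous_mult[OF Suc pole[of "Suc n"]] by (simp add: poles_Suc)
  qed
qed

lemma homogeneous_fibre_num: "homogeneous (n + 1) (fibre_num n)"
proof (induction n)
  case 0
  show ?case
    using homogeneous_linear3 by simp
next
  case (Suc n)
  have "homogeneous (n + 1 + 1) (poles n * (const3 (\<beta> 0) * X0 + const3 (\<beta> 1) * base (Suc n)))"
    by (intro homogeneous_mult homogeneous_poles homogeneous_add homogeneous_const3_mult
        homogeneous_X0 homogeneous_base)
  moreover have "homogeneous (1 + (n + 1)) (const3 (\<beta> 2) * X0 * fibre_num n)"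
    by (intro homogeneous_mult Suc homogeneous_const3_mult homogeneous_X0)
  ultimately show ?case
    by (simp add: homogeneous_add)
qed

lemma proj_iter_skew:
  "\<exists>T. T \<noteq> 0 \<and> proj_iter (proj_map \<alpha> \<beta> \<gamma>) (Suc n) =
    scale T (X0 * poles n, base (Suc n) * poles n, X0 * fibre_num n)"
proof (induction n)
  case 0
  show ?case
    by (intro exI[of _ 1])
      (simp add: proj_iter_Suc proj_iter_0 proj_comp_proj_map linear_form_X poles_def pole_def linear3_def \<alpha>_2 \<gamma>_2)
next
  case (Suc n)
  then obtain T where T: "T \<noteq> 0" "proj_iter (proj_map \<alpha> \<beta> \<gamma>) (Suc n) =
      scale T (X0 * poles n, base (Suc n) * poles n, X0 * fibre_num n)"
    by blast
  let ?v = "(X0 * poles n, base (Suc n) * poles n, X0 * fibre_num n)"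
  have "linear_form \<gamma> ?v = poles (Suc n)" "linear_form \<alpha> ?v = poles n * base (Suc (Suc n))"
    "linear_form \<beta> ?v = fibre_num (Suc n)"
    by (simp_all add: linear_form_def poles_Suc pole_def \<alpha>_2 \<gamma>_2 algebra_simps)
  then have "proj_comp (proj_map \<alpha> \<beta> \<gamma>) ?v =
      scale (poles n) (X0 * poles (Suc n), base (Suc (Suc n)) * poles (Suc n), X0 * fibre_num (Suc n))"
    by (simp add: proj_comp_proj_map mult_ac del: base.simps fibre_num.simps)
  then have "proj_iter (proj_map \<alpha> \<beta> \<gamma>) (Suc (Suc n)) = scale (T * T * poles n)
      (X0 * poles (Suc n), base (Suc (Suc n)) * poles (Suc n), X0 * fibre_num (Suc n))"
    by (simp only: proj_iter_Suc[of _ "Suc n"] T(2) proj_comp_scale scale_scale)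
  with T(1) poles_nonzero show ?case
    by (intro exI[of _ "T * T * poles n"]) simp
qed

lemma degree_skew: "proj_degree (proj_iter (proj_map \<alpha> \<beta> \<gamma>) n) = 1 + n"
proof (cases n)
  case 0
  then show ?thesis
    by (simp add: proj_degree_iter_0)
next
  case (Suc m)
  obtain T where T: "T \<noteq> 0" "proj_iter (proj_map \<alpha> \<beta> \<gamma>) n =
      scale T (X0 * poles m, base (Suc m) * poles m, X0 * fibre_num m)"
    using proj_iter_skew Suc by blast
  have deg: "1 + n = 1 + (m + 1)"
    by (simp add: Suc)
  show ?thesis
    unfolding T(2) deg
  proof (rule proj_degree_scale)
    fix \<pi>
    assume "prime \<pi>" "\<pi> dvd X0 * poles m" "\<pi> dvd base (Suc m) * poles m" "\<pi> dvd X0 * fibre_num m"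
    then show False
      using prime_X0_not_dvd_base prime_X0_not_dvd_poles prime_not_dvd_poles_and_fibre_num
      unfolding prime_dvd_mult_iff[OF \<open>prime \<pi>\<close>] by blast
  qed (intro homogeneous_mult homogeneous_X0 homogeneous_base homogeneous_poles homogeneous_fibre_num
      | simp add: T(1) poles_nonzero)+
qed

end


section \<open>Growth rates\<close>

lemma root_tendsto_if_geometric_bounds:
  fixes d :: "nat \<Rightarrow> nat"
  assumes "\<delta> > 0" "c > 0" "\<And>n. \<delta> ^ n \<le> real (d n)" "\<And>n. real (d n) \<le> c * \<delta> ^ n"
  shows "(\<lambda>n. root n (real (d n))) \<longlonglongrightarrow> \<delta>"
proof (rule tendsto_sandwich)
  have "\<delta> = root n (\<delta> ^ n)" if "n > 0" for n
    using that assms(1) by (simp add: real_root_power_cancel)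
  then have "\<delta> \<le> root n (real (d n)) \<and> root n (real (d n)) \<le> root n c * \<delta>" if "n > 0" for n
    using that assms(3,4)[of n] by (metis real_root_le_iff real_root_mult)
  then show "\<forall>\<^sub>F n in sequentially. \<delta> \<le> root n (real (d n))"
    "\<forall>\<^sub>F n in sequentially. root n (real (d n)) \<le> root n c * \<delta>"
    by (auto intro: eventually_mono[OF eventually_gt_at_top[of 0]])
  show "(\<lambda>n. root n c * \<delta>) \<longlonglongrightarrow> \<delta>"
    using tendsto_mult_right[OF LIMSEQ_root_const[OF assms(2)], of \<delta>] by simp
qed simp

lemma fib_geometric_bounds:
  defines "\<phi> \<equiv> (1 + sqrt 5) / 2"
  shows "\<phi> ^ n \<le> real (fib (n + 2)) \<and> real (fib (n + 2)) \<le> \<phi> * \<phi> ^ n"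
proof -
  have \<phi>: "\<phi> * \<phi> = \<phi> + 1"
    by (simp add: \<phi>_def field_simps)
  have "sqrt 5 \<le> 3" "2 \<le> sqrt 5"
    by (rule real_le_lsqrt real_le_rsqrt; simp)+
  then have bounds: "1 \<le> \<phi>" "\<phi> \<le> 2"
    by (simp_all add: \<phi>_def)
  have power: "\<phi> ^ Suc (Suc n) = \<phi> ^ Suc n + \<phi> ^ n" for n
    using \<phi> by (simp add: algebra_simps flip: mult.assoc)
  show ?thesis
  proof (induction n rule: fib.induct)
    case 1
    show ?case
      using bounds by (simp add: numeral_2_eq_2)
  next
    case 2
    show ?case
      using bounds \<phi> by (simp add: numeral_2_eq_2 numeral_3_eq_3)
  next
    case (3 n)
    have "fib (Suc (Suc n) + 2) = fib (Suc n + 2) + fib (n + 2)"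
      by simp
    with 3 show ?case
      unfolding power by (simp add: distrib_left)
  qed
qed

lemma root_Suc_tendsto_1: "(\<lambda>n. root n (real (1 + n))) \<longlonglongrightarrow> 1"
proof (rule tendsto_sandwich)
  have "1 \<le> root n (real (1 + n)) \<and> root n (real (1 + n)) \<le> root n 2 * root n (real n)" if "n > 0" for n
    using that by (simp flip: real_root_mult)
  then show "\<forall>\<^sub>F n in sequentially. 1 \<le> root n (real (1 + n))"
    "\<forall>\<^sub>F n in sequentially. root n (real (1 + n)) \<le> root n 2 * root n (real n)"
    by (auto intro: eventually_mono[OF eventually_gt_at_top[of 0]])
  show "(\<lambda>n. root n 2 * root n (real n)) \<longlonglongrightarrow> 1"
    using tendsto_mult[OF LIMSEQ_root_const[of 2] LIMSEQ_root] by simp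
qed simp

theorem theorem4:
  fixes \<alpha> \<beta> \<gamma> :: "nat \<Rightarrow> complex"
  assumes "(\<gamma> 1, \<gamma> 2) \<noteq> (0, 0)"
    and "birational (plane_map \<alpha> \<beta> \<gamma>)"
    and "\<alpha> 1 * \<gamma> 2 - \<alpha> 2 * \<gamma> 1 = 0"
  shows "let F = proj_map \<alpha> \<beta> \<gamma>; d = (\<lambda>n. proj_degree (proj_iter F n)) in
    (\<alpha> 1 \<noteq> 0 \<and> \<alpha> 2 \<noteq> 0 \<and> \<gamma> 1 \<noteq> 0 \<and> \<gamma> 2 \<noteq> 0 \<longrightarrow>
      has_dynamical_degree F 2) \<and>
    (\<alpha> 1 = 0 \<and> \<gamma> 1 = 0 \<longrightarrow>
      has_dynamical_degree F ((1 + sqrt 5) / 2) \<and> (\<forall>n. d (n + 2) = d (n + 1) + d n)) \<and>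
    (\<alpha> 2 = 0 \<and> \<gamma> 2 = 0 \<longrightarrow>
      has_dynamical_degree F 1 \<and> (\<forall>n. d n = 1 + n))"
proof -
  define F where "F = proj_map \<alpha> \<beta> \<gamma>"
  define d where "d = (\<lambda>n. proj_degree (proj_iter F n))"
  obtain \<kappa> where \<kappa>: "\<kappa> \<noteq> 0" "\<alpha> 1 = \<kappa> * \<gamma> 1" "\<alpha> 2 = \<kappa> * \<gamma> 2"
    and det: "\<beta> 1 * \<gamma> 2 - \<beta> 2 * \<gamma> 1 \<noteq> 0"
    using birational_nondegenerate[OF assms] .
  have proportional: "proportional_map \<alpha> \<beta> \<gamma> \<kappa>" if "\<gamma> 2 \<noteq> 0"
    using that \<kappa> det by unfold_locales
  have degree_limit: "has_dynamical_degree F \<delta> \<longleftrightarrow> (\<lambda>n. root n (real (d n))) \<longlonglongrightarrow> \<delta>" for \<delta>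
    by (simp add: has_dynamical_degree_def d_def)
  have "has_dynamical_degree F 2" if "\<alpha> 1 \<noteq> 0" "\<gamma> 2 \<noteq> 0"
  proof -
    interpret proportional_map \<alpha> \<beta> \<gamma> \<kappa>
      using proportional that(2) .
    have "d n = 2 ^ n" for n
      using degree_quadratic that(1) by (simp add: d_def F_def quadratic_coeff_def)
    then show ?thesis
      unfolding degree_limit by (intro root_tendsto_if_geometric_bounds[where c = 1]) simp_all
  qed
  moreover have "has_dynamical_degree F ((1 + sqrt 5) / 2) \<and> (\<forall>n. d (n + 2) = d (n + 1) + d n)"
    if "\<alpha> 1 = 0" "\<gamma> 1 = 0"
  proof -
    have "\<gamma> 2 \<noteq> 0"
      using assms(1) that(2) by simp
    then interpret proportional_map \<alpha> \<beta> \<gamma> \<kappa>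
      by (rule proportional)
    have d: "d n = fib (n + 2)" for n
      using degree_fib that(1) by (simp add: d_def F_def quadratic_coeff_def)
    have "(1 + sqrt 5) / 2 > (0 :: real)"
      by (simp add: add_pos_nonneg)
    then have "has_dynamical_degree F ((1 + sqrt 5) / 2)"
      unfolding degree_limit d using fib_geometric_bounds
      by (intro root_tendsto_if_geometric_bounds[where c = "(1 + sqrt 5) / 2"]) blast+
    then show ?thesis
      by (simp add: d)
  qed
  moreover have "has_dynamical_degree F 1 \<and> (\<forall>n. d n = 1 + n)" if "\<alpha> 2 = 0" "\<gamma> 2 = 0"
  proof -
    interpret skew_map \<alpha> \<beta> \<gamma>
      using that assms(1) \<kappa> det by unfold_locales auto
    have d: "d n = 1 + n" for n
      using degree_skew by (simp add: d_def F_def)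
    then show ?thesis
      unfolding degree_limit d using root_Suc_tendsto_1 by simp
  qed
  ultimately show ?thesis
    unfolding F_def d_def Let_def by blast
qed

end
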